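(* Let $X$ be a simplicial object in a category $P$. To give duplicial structure to $X$ is equivalently to give a simplicial map $t\colon \mathrm{Dec}_r X\to \mathrm{Dec}_l X$ such that $$\epsilon^l_X\circ t=\epsilon^r_X\colon \mathrm{Dec}_r X\to X$$ and $$\delta^l_X\circ t=\mathrm{Dec}_l(t)\circ \mathrm{Dec}_r(t)\circ\delta^r_X\colon \mathrm{Dec}_r X\to \mathrm{Dec}_l\mathrm{Dec}_l X,$$ where in the second equation $\mathrm{Dec}_r(t)\colon \mathrm{Dec}_r\mathrm{Dec}_rX\to\mathrm{Dec}_r\mathrm{Dec}_lX=\mathrm{Dec}_l\mathrm{Dec}_rX$ and $\mathrm{Dec}_l(t)\colon\mathrm{Dec}_l\mathrm{Dec}_rX\to\mathrm{Dec}_l\mathrm{Dec}_lX$.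
   Context: A simplicial object $X$ in $P$ is a functor $\Delta^{\mathrm{op}}\to P$, with faces $d_i\colon X_n\to X_{n-1}$ (for $n\ge 1$) and degeneracies $s_i\colon X_n\to X_{n+1}$ for $0\le i\le n$. Duplicial structure on $X$ consists of morphisms $t_n\colon X_n\to X_n$ for all $n\geq 0$ such that, for all $n\ge 0$: (1) $d_i t_{n+1}=t_n d_{i-1}$ for $1\le i\le n+1$, and $d_0t_{n+1}=d_{n+1}$; (2) $s_it_n=t_{n+1}s_{i-1}$ for $1\le i\le n$, and $s_0t_n=t_{n+1}^2s_n$. The right decalage comonad $\mathrm{Dec}_r$ on the category $[\Delta^{\mathrm{op}},P]$ of simplicial objects: $(\mathrm{Dec}_rX)_n=X_{n+1}$, discarding the last face and last degeneracy in each degree, so that the $i$-th face $X_{n+1}\to X_n$ is $d_i$ and the $i$-th degeneracy $X_{n+1}\to X_{n+2}$ is $s_i$ ($0\le i\le n$). Its counit $\epsilon^r_X\colon\mathrm{Dec}_rX\to X$ has degree-$n$ component $d_{n+1}\colon X_{n+1}\to X_n$ and its comultiplication $\delta^r_X\colon \mathrm{Dec}_rX\to\mathrm{Dec}_r\mathrm{Dec}_rX$ has degree-$n$ component $s_{n+1}\colon X_{n+1}\to X_{n+2}$. The left decalage comonad $\mathrm{Dec}_l$ on $[\Delta^{\mathrm{op}},P]$: $(\mathrm{Dec}_lX)_n=X_{n+1}$, discarding the first face and first degeneracy in each degree, so that the $i$-th face $X_{n+1}\to X_n$ is $d_{i+1}$ and the $i$-th degeneracy $X_{n+1}\to X_{n+2}$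 is $s_{i+1}$ ($0\le i\le n$). Its counit $\epsilon^l_X\colon\mathrm{Dec}_lX\to X$ has degree-$n$ component $d_0\colon X_{n+1}\to X_n$ and its comultiplication $\delta^l_X\colon \mathrm{Dec}_lX\to\mathrm{Dec}_l\mathrm{Dec}_lX$ has degree-$n$ component $s_0\colon X_{n+1}\to X_{n+2}$. One has $\mathrm{Dec}_r\mathrm{Dec}_l=\mathrm{Dec}_l\mathrm{Dec}_r$. *)

theory Defs
  imports "HOL-Library.FuncSet"
begin

section \<open>Categories, functors, natural transformations\<close>

record ('o, 'm) cat =
  Ob :: "'o set"
  Arr :: "'m set"
  Dom :: "'m \<Rightarrow> 'o"
  Cod :: "'m \<Rightarrow> 'o"
  Id :: "'o \<Rightarrow> 'm"
  Comp :: "'m \<Rightarrow> 'm \<Rightarrow> 'm"  (infixl \<open>\<cdot>\<index>\<close> 70)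

definition Hom :: "('o, 'm) cat \<Rightarrow> 'o \<Rightarrow> 'o \<Rightarrow> 'm set" where
  "Hom C a b = {f \<in> Arr C. Dom C f = a \<and> Cod C f = b}"

locale category =
  fixes C :: "('o, 'm) cat" (structure)
  assumes Dom_Ob: "f \<in> Arr C \<Longrightarrow> Dom C f \<in> Ob C"
    and Cod_Ob: "f \<in> Arr C \<Longrightarrow> Cod C f \<in> Ob C"
    and Id_Hom: "a \<in> Ob C \<Longrightarrow> Id C a \<in> Hom C a a"
    and Comp_Hom: "f \<in> Hom C a b \<Longrightarrow> g \<in> Hom C b c \<Longrightarrow> g \<cdot> f \<in> Hom C a c"
    and Comp_assoc: "f \<in> Hom C a b \<Longrightarrow> g \<in> Hom C b c \<Longrightarrow> h \<in> Hom C c d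
      \<Longrightarrow> h \<cdot> (g \<cdot> f) = (h \<cdot> g) \<cdot> f"
    and Id_left: "f \<in> Hom C a b \<Longrightarrow> Id C b \<cdot> f = f"
    and Id_right: "f \<in> Hom C a b \<Longrightarrow> f \<cdot> Id C a = f"

definition op_cat :: "('o, 'm) cat \<Rightarrow> ('o, 'm) cat" where
  "op_cat C = \<lparr>Ob = Ob C, Arr = Arr C, Dom = Cod C, Cod = Dom C, Id = Id C,
     Comp = (\<lambda>g f. f \<cdot>\<^bsub>C\<^esub> g)\<rparr>"

record ('o1, 'm1, 'o2, 'm2) fctr =
  ob_map :: "'o1 \<Rightarrow> 'o2"
  arr_map :: "'m1 \<Rightarrow> 'm2"

definition is_functor ::
  "('o1, 'm1) cat \<Rightarrow> ('o2, 'm2) cat \<Rightarrow> ('o1, 'm1, 'o2, 'm2) fctr \<Rightarrow> bool" where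
  "is_functor C D F \<longleftrightarrow>
     (\<forall>a \<in> Ob C. ob_map F a \<in> Ob D) \<and>
     (\<forall>a \<in> Ob C. \<forall>b \<in> Ob C. \<forall>f \<in> Hom C a b. arr_map F f \<in> Hom D (ob_map F a) (ob_map F b)) \<and>
     (\<forall>a \<in> Ob C. arr_map F (Id C a) = Id D (ob_map F a)) \<and>
     (\<forall>a \<in> Ob C. \<forall>b \<in> Ob C. \<forall>c \<in> Ob C. \<forall>f \<in> Hom C a b. \<forall>g \<in> Hom C b c.
        arr_map F (g \<cdot>\<^bsub>C\<^esub> f) = arr_map F g \<cdot>\<^bsub>D\<^esub> arr_map F f)"

definition is_nat_trans ::
  "('o1, 'm1) cat \<Rightarrow> ('o2, 'm2) cat \<Rightarrow> ('o1, 'm1, 'o2, 'm2) fctr \<Rightarrow>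
   ('o1, 'm1, 'o2, 'm2) fctr \<Rightarrow> ('o1 \<Rightarrow> 'm2) \<Rightarrow> bool" where
  "is_nat_trans C D F G t \<longleftrightarrow>
     (\<forall>a \<in> Ob C. t a \<in> Hom D (ob_map F a) (ob_map G a)) \<and>
     (\<forall>a \<in> Ob C. \<forall>b \<in> Ob C. \<forall>f \<in> Hom C a b.
        t b \<cdot>\<^bsub>D\<^esub> arr_map F f = arr_map G f \<cdot>\<^bsub>D\<^esub> t a)"

section \<open>The simplex category and simplicial objects\<close>

text \<open>The object \<open>n\<close> stands for \<open>[n] = {0 < \<dots> < n}\<close>. An arrow \<open>[m] \<rightarrow> [n]\<close> is a triple
  \<open>(m, n, f)\<close> with \<open>f\<close> monotone and extensional, i.e. \<open>undefined\<close> outside \<open>{..m}\<close>, so that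
  equality of arrows is equality of monotone maps.\<close>

type_synonym simplex_arr = "nat \<times> nat \<times> (nat \<Rightarrow> nat)"

definition Delta :: "(nat, simplex_arr) cat" where
  "Delta = \<lparr>Ob = UNIV,
     Arr = {(m, n, f). f \<in> {..m} \<rightarrow>\<^sub>E {..n} \<and> mono_on {..m} f},
     Dom = (\<lambda>(m, n, f). m),
     Cod = (\<lambda>(m, n, f). n),
     Id = (\<lambda>n. (n, n, \<lambda>k\<in>{..n}. k)),
     Comp = (\<lambda>(n', p, g) (m, n, f). (m, p, compose {..m} g f))\<rparr>"

type_synonym ('o, 'm) sobj = "(nat, simplex_arr, 'o, 'm) fctr"

definition simplicial_object :: "('o, 'm) cat \<Rightarrow> ('o, 'm) sobj \<Rightarrow> bool" where
  "simplicial_object P X \<longleftrightarrow> is_functor (op_cat Delta) P X"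

text \<open>All of \<open>nat\<close> is the object set of \<open>Delta\<close>, so simplicial maps are equal iff they are equal
  as functions.\<close>

definition simplicial_map ::
  "('o, 'm) cat \<Rightarrow> ('o, 'm) sobj \<Rightarrow> ('o, 'm) sobj \<Rightarrow> (nat \<Rightarrow> 'm) \<Rightarrow> bool" where
  "simplicial_map P X Y t \<longleftrightarrow> is_nat_trans (op_cat Delta) P X Y t"

definition smap_comp :: "('o, 'm) cat \<Rightarrow> (nat \<Rightarrow> 'm) \<Rightarrow> (nat \<Rightarrow> 'm) \<Rightarrow> nat \<Rightarrow> 'm" where
  "smap_comp P u t = (\<lambda>n. u n \<cdot>\<^bsub>P\<^esub> t n)"

text \<open>\<open>coface n i : [n - 1] \<rightarrow> [n]\<close> (for \<open>n \<ge> 1\<close>) omits the value \<open>i\<close>;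
  \<open>codegen n i : [n + 1] \<rightarrow> [n]\<close> takes the value \<open>i\<close> twice. In \<open>face X n i\<close> and
  \<open>degen X n i\<close> the number \<open>n\<close> is the degree of the source.\<close>

definition coface :: "nat \<Rightarrow> nat \<Rightarrow> simplex_arr" where
  "coface n i = (n - 1, n, \<lambda>k\<in>{..n - 1}. if k < i then k else k + 1)"

definition codegen :: "nat \<Rightarrow> nat \<Rightarrow> simplex_arr" where
  "codegen n i = (n + 1, n, \<lambda>k\<in>{..n + 1}. if k \<le> i then k else k - 1)"

definition face :: "('o, 'm) sobj \<Rightarrow> nat \<Rightarrow> nat \<Rightarrow> 'm" where
  "face X n i = arr_map X (coface n i)"

definition degen :: "('o, 'm) sobj \<Rightarrow> nat \<Rightarrow> nat \<Rightarrow> 'm" where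
  "degen X n i = arr_map X (codegen n i)"

section \<open>Duplicial structure\<close>

definition duplicial_structure ::
  "('o, 'm) cat \<Rightarrow> ('o, 'm) sobj \<Rightarrow> (nat \<Rightarrow> 'm) \<Rightarrow> bool" where
  "duplicial_structure P X t \<longleftrightarrow>
     (\<forall>n. t n \<in> Hom P (ob_map X n) (ob_map X n)) \<and>
     (\<forall>n. (\<forall>i \<in> {1..n + 1}.
             face X (n + 1) i \<cdot>\<^bsub>P\<^esub> t (n + 1) = t n \<cdot>\<^bsub>P\<^esub> face X (n + 1) (i - 1)) \<and>
          face X (n + 1) 0 \<cdot>\<^bsub>P\<^esub> t (n + 1) = face X (n + 1) (n + 1)) \<and>
     (\<forall>n. (\<forall>i \<in> {1..n}.
             degen X n i \<cdot>\<^bsub>P\<^esub> t n = t (n + 1) \<cdot>\<^bsub>P\<^esub> degen X n (i - 1)) \<and>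
          degen X n 0 \<cdot>\<^bsub>P\<^esub> t n = (t (n + 1) \<cdot>\<^bsub>P\<^esub> t (n + 1)) \<cdot>\<^bsub>P\<^esub> degen X n n)"

section \<open>The decalage comonads\<close>

text \<open>\<open>Dec_r\<close> and \<open>Dec_l\<close> are precomposition with the endofunctors of \<open>Delta\<close> that adjoin a new
  top, respectively bottom, element. Discarding the last (first) face and degeneracy is then a
  consequence; see \<open>face_Dec_r\<close>, \<open>degen_Dec_r\<close>, \<open>face_Dec_l\<close>, \<open>degen_Dec_l\<close> below.\<close>

definition add_top :: "simplex_arr \<Rightarrow> simplex_arr" where
  "add_top = (\<lambda>(m, n, f). (m + 1, n + 1, \<lambda>k\<in>{..m + 1}. if k \<le> m then f k else n + 1))"

definition add_bot :: "simplex_arr \<Rightarrow> simplex_arr" where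
  "add_bot = (\<lambda>(m, n, f). (m + 1, n + 1, \<lambda>k\<in>{..m + 1}. if k = 0 then 0 else f (k - 1) + 1))"

definition Dec_r :: "('o, 'm) sobj \<Rightarrow> ('o, 'm) sobj" where
  "Dec_r X = \<lparr>ob_map = (\<lambda>n. ob_map X (n + 1)), arr_map = (\<lambda>f. arr_map X (add_top f))\<rparr>"

definition Dec_l :: "('o, 'm) sobj \<Rightarrow> ('o, 'm) sobj" where
  "Dec_l X = \<lparr>ob_map = (\<lambda>n. ob_map X (n + 1)), arr_map = (\<lambda>f. arr_map X (add_bot f))\<rparr>"

text \<open>The action on simplicial maps is whiskering, so both functors shift the components.\<close>

definition Dec_r_map :: "(nat \<Rightarrow> 'm) \<Rightarrow> nat \<Rightarrow> 'm" where
  "Dec_r_map t = (\<lambda>n. t (n + 1))"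

definition Dec_l_map :: "(nat \<Rightarrow> 'm) \<Rightarrow> nat \<Rightarrow> 'm" where
  "Dec_l_map t = (\<lambda>n. t (n + 1))"

definition counit_r :: "('o, 'm) sobj \<Rightarrow> nat \<Rightarrow> 'm" where
  "counit_r X = (\<lambda>n. face X (n + 1) (n + 1))"

definition comult_r :: "('o, 'm) sobj \<Rightarrow> nat \<Rightarrow> 'm" where
  "comult_r X = (\<lambda>n. degen X (n + 1) (n + 1))"

definition counit_l :: "('o, 'm) sobj \<Rightarrow> nat \<Rightarrow> 'm" where
  "counit_l X = (\<lambda>n. face X (n + 1) 0)"

definition comult_l :: "('o, 'm) sobj \<Rightarrow> nat \<Rightarrow> 'm" where
  "comult_l X = (\<lambda>n. degen X (n + 1) 0)"

section \<open>Consistency of the definitions\<close>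

lemma Delta_simps [simp]:
  "Ob Delta = UNIV"
  "Dom Delta (m, n, f) = m"
  "Cod Delta (m, n, f) = n"
  "Id Delta n = (n, n, \<lambda>k\<in>{..n}. k)"
  "(n', p, g) \<cdot>\<^bsub>Delta\<^esub> (m, n, f) = (m, p, compose {..m} g f)"
  by (auto simp: Delta_def)

lemma op_cat_simps [simp]:
  "Ob (op_cat C) = Ob C"
  "Arr (op_cat C) = Arr C"
  "Dom (op_cat C) = Cod C"
  "Cod (op_cat C) = Dom C"
  "Id (op_cat C) = Id C"
  "Hom (op_cat C) a b = Hom C b a"
  "g \<cdot>\<^bsub>op_cat C\<^esub> f = f \<cdot>\<^bsub>C\<^esub> g"
  by (auto simp: op_cat_def Hom_def)

lemma Hom_Delta:
  "x \<in> Hom Delta m n \<longleftrightarrow> (\<exists>f. x = (m, n, f) \<and> f \<in> {..m} \<rightarrow>\<^sub>E {..n} \<and> mono_on {..m} f)"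
  by (cases x) (auto simp: Hom_def Delta_def)

lemma category_Delta: "category Delta"
proof
  show "f \<in> Hom Delta a b \<Longrightarrow> g \<in> Hom Delta b c \<Longrightarrow> g \<cdot>\<^bsub>Delta\<^esub> f \<in> Hom Delta a c" for f g a b c
    by (fastforce simp: Hom_Delta compose_def mono_on_def PiE_iff)
  show "f \<in> Hom Delta a b \<Longrightarrow> g \<in> Hom Delta b c \<Longrightarrow> h \<in> Hom Delta c d
      \<Longrightarrow> h \<cdot>\<^bsub>Delta\<^esub> (g \<cdot>\<^bsub>Delta\<^esub> f) = h \<cdot>\<^bsub>Delta\<^esub> g \<cdot>\<^bsub>Delta\<^esub> f" for f g h a b c d
    by (auto simp: Hom_Delta compose_def PiE_iff fun_eq_iff)
  show "f \<in> Hom Delta a b \<Longrightarrow> Id Delta b \<cdot>\<^bsub>Delta\<^esub> f = f" for f a b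
    by (auto simp: Hom_Delta compose_def PiE_iff fun_eq_iff extensional_def)
  show "f \<in> Hom Delta a b \<Longrightarrow> f \<cdot>\<^bsub>Delta\<^esub> Id Delta a = f" for f a b
    by (auto simp: Hom_Delta compose_def PiE_iff fun_eq_iff extensional_def)
qed (auto simp: Hom_Delta mono_on_def)

lemma category_op: "category C \<Longrightarrow> category (op_cat C)"
proof -
  assume "category C"
  then interpret category C .
  show ?thesis
    by standard (simp_all add: Dom_Ob Cod_Ob Id_Hom Comp_Hom Id_left Id_right Comp_assoc[symmetric])
qed

lemma coface_Hom: "n \<ge> 1 \<Longrightarrow> i \<le> n \<Longrightarrow> coface n i \<in> Hom Delta (n - 1) n"
  by (auto simp: Hom_Delta coface_def mono_on_def)

lemma codegen_Hom: "i \<le> n \<Longrightarrow> codegen n i \<in> Hom Delta (n + 1) n"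
  by (auto simp: Hom_Delta codegen_def mono_on_def)

lemma add_top_Hom: "f \<in> Hom Delta m n \<Longrightarrow> add_top f \<in> Hom Delta (m + 1) (n + 1)"
  by (fastforce simp: Hom_Delta add_top_def mono_on_def PiE_iff le_Suc_eq)

lemma add_bot_Hom: "f \<in> Hom Delta m n \<Longrightarrow> add_bot f \<in> Hom Delta (m + 1) (n + 1)"
  by (auto simp: Hom_Delta add_bot_def mono_on_def PiE_iff le_diff_conv less_Suc_eq_le)

lemma add_top_Comp:
  "f \<in> Hom Delta a b \<Longrightarrow> g \<in> Hom Delta b c \<Longrightarrow>
   add_top (g \<cdot>\<^bsub>Delta\<^esub> f) = add_top g \<cdot>\<^bsub>Delta\<^esub> add_top f"
  by (force simp: Hom_Delta add_top_def compose_def PiE_iff fun_eq_iff)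

lemma add_bot_Comp:
  "f \<in> Hom Delta a b \<Longrightarrow> g \<in> Hom Delta b c \<Longrightarrow>
   add_bot (g \<cdot>\<^bsub>Delta\<^esub> f) = add_bot g \<cdot>\<^bsub>Delta\<^esub> add_bot f"
  by (force simp: Hom_Delta add_bot_def compose_def PiE_iff fun_eq_iff)

lemma add_top_Id: "add_top (Id Delta n) = Id Delta (n + 1)"
  by (auto simp: add_top_def fun_eq_iff)

lemma add_bot_Id: "add_bot (Id Delta n) = Id Delta (n + 1)"
  by (auto simp: add_bot_def fun_eq_iff)

lemma functor_op_Comp:
  "simplicial_object P X \<Longrightarrow> f \<in> Hom Delta a b \<Longrightarrow> g \<in> Hom Delta b c \<Longrightarrow>
   arr_map X f \<cdot>\<^bsub>P\<^esub> arr_map X g = arr_map X (g \<cdot>\<^bsub>Delta\<^esub> f)"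
  by (simp add: simplicial_object_def is_functor_def)

lemma functor_op_Hom:
  "simplicial_object P X \<Longrightarrow> f \<in> Hom Delta a b \<Longrightarrow>
   arr_map X f \<in> Hom P (ob_map X b) (ob_map X a)"
  by (simp add: simplicial_object_def is_functor_def)

lemma simplicial_object_Dec_r:
  assumes X: "simplicial_object P X"
  shows "simplicial_object P (Dec_r X)"
proof -
  have "arr_map X (add_top (g \<cdot>\<^bsub>Delta\<^esub> f)) = arr_map X (add_top f) \<cdot>\<^bsub>P\<^esub> arr_map X (add_top g)"
    if "f \<in> Hom Delta a b" "g \<in> Hom Delta b c" for f g a b c
    using functor_op_Comp[OF X add_top_Hom[OF that(1)] add_top_Hom[OF that(2)]] add_top_Comp[OF that]
    by simp
  moreover have "ob_map X n \<in> Ob P" "arr_map X (Id Delta n) = Id P (ob_map X n)" for n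
    using X by (simp_all add: simplicial_object_def is_functor_def del: Delta_simps(4))
  ultimately show ?thesis
    using functor_op_Hom[OF X add_top_Hom] add_top_Id
    by (simp add: simplicial_object_def is_functor_def Dec_r_def del: Delta_simps(4,5))
qed

lemma simplicial_object_Dec_l:
  assumes X: "simplicial_object P X"
  shows "simplicial_object P (Dec_l X)"
proof -
  have "arr_map X (add_bot (g \<cdot>\<^bsub>Delta\<^esub> f)) = arr_map X (add_bot f) \<cdot>\<^bsub>P\<^esub> arr_map X (add_bot g)"
    if "f \<in> Hom Delta a b" "g \<in> Hom Delta b c" for f g a b c
    using functor_op_Comp[OF X add_bot_Hom[OF that(1)] add_bot_Hom[OF that(2)]] add_bot_Comp[OF that]
    by simp
  moreover have "ob_map X n \<in> Ob P" "arr_map X (Id Delta n) = Id P (ob_map X n)" for n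
    using X by (simp_all add: simplicial_object_def is_functor_def del: Delta_simps(4))
  ultimately show ?thesis
    using functor_op_Hom[OF X add_bot_Hom] add_bot_Id
    by (simp add: simplicial_object_def is_functor_def Dec_l_def del: Delta_simps(4,5))
qed

lemma face_Dec_r: "n \<ge> 1 \<Longrightarrow> i \<le> n \<Longrightarrow> face (Dec_r X) n i = face X (n + 1) i"
  by (auto simp: face_def Dec_r_def add_top_def coface_def fun_eq_iff intro!: arg_cong[of _ _ "arr_map X"])

lemma degen_Dec_r: "i \<le> n \<Longrightarrow> degen (Dec_r X) n i = degen X (n + 1) i"
  by (auto simp: degen_def Dec_r_def add_top_def codegen_def fun_eq_iff intro!: arg_cong[of _ _ "arr_map X"])

lemma face_Dec_l: "n \<ge> 1 \<Longrightarrow> i \<le> n \<Longrightarrow> face (Dec_l X) n i = face X (n + 1) (i + 1)"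
  by (auto simp: face_def Dec_l_def add_bot_def coface_def fun_eq_iff intro!: arg_cong[of _ _ "arr_map X"])

lemma degen_Dec_l: "i \<le> n \<Longrightarrow> degen (Dec_l X) n i = degen X (n + 1) (i + 1)"
  by (auto simp: degen_def Dec_l_def add_bot_def codegen_def fun_eq_iff intro!: arg_cong[of _ _ "arr_map X"])

lemma Dec_r_Dec_l: "Dec_r (Dec_l X) = Dec_l (Dec_r X)"
proof -
  have "add_bot (add_top f) = add_top (add_bot f)" for f
    by (cases f) (auto simp: add_bot_def add_top_def fun_eq_iff)
  then show ?thesis
    by (simp add: Dec_r_def Dec_l_def)
qed

lemma simplicial_map_Dec_r:
  "simplicial_map P X Y t \<Longrightarrow> simplicial_map P (Dec_r X) (Dec_r Y) (Dec_r_map t)"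
  using add_top_Hom by (simp add: simplicial_map_def is_nat_trans_def Dec_r_def Dec_r_map_def)

lemma simplicial_map_Dec_l:
  "simplicial_map P X Y t \<Longrightarrow> simplicial_map P (Dec_l X) (Dec_l Y) (Dec_l_map t)"
  using add_bot_Hom by (simp add: simplicial_map_def is_nat_trans_def Dec_l_def Dec_l_map_def)

lemma Delta_counit_r:
  "f \<in> Hom Delta m n \<Longrightarrow>
   coface (n + 1) (n + 1) \<cdot>\<^bsub>Delta\<^esub> f = add_top f \<cdot>\<^bsub>Delta\<^esub> coface (m + 1) (m + 1)"
  by (auto simp: Hom_Delta coface_def add_top_def compose_def PiE_iff fun_eq_iff less_Suc_eq_le)

lemma Delta_counit_l:
  "f \<in> Hom Delta m n \<Longrightarrow>
   coface (n + 1) 0 \<cdot>\<^bsub>Delta\<^esub> f = add_bot f \<cdot>\<^bsub>Delta\<^esub> coface (m + 1) 0"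
  by (auto simp: Hom_Delta coface_def add_bot_def compose_def PiE_iff fun_eq_iff)

lemma Delta_comult_r:
  "f \<in> Hom Delta m n \<Longrightarrow>
   codegen (n + 1) (n + 1) \<cdot>\<^bsub>Delta\<^esub> add_top (add_top f) =
   add_top f \<cdot>\<^bsub>Delta\<^esub> codegen (m + 1) (m + 1)"
  by (auto simp: Hom_Delta codegen_def add_top_def compose_def PiE_iff fun_eq_iff le_Suc_eq)

lemma Delta_comult_l:
  "f \<in> Hom Delta m n \<Longrightarrow>
   codegen (n + 1) 0 \<cdot>\<^bsub>Delta\<^esub> add_bot (add_bot f) =
   add_bot f \<cdot>\<^bsub>Delta\<^esub> codegen (m + 1) 0"
  by (auto simp: Hom_Delta codegen_def add_bot_def compose_def PiE_iff fun_eq_iff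
      le_diff_conv)

lemma simplicial_map_counit_r:
  assumes X: "simplicial_object P X"
  shows "simplicial_map P (Dec_r X) X (counit_r X)"
proof -
  have c: "coface (n + 1) (n + 1) \<in> Hom Delta n (n + 1)" for n
    using coface_Hom[of "n + 1" "n + 1"] by simp
  have "arr_map X (coface (m + 1) (m + 1)) \<cdot>\<^bsub>P\<^esub> arr_map X (add_top f) =
        arr_map X f \<cdot>\<^bsub>P\<^esub> arr_map X (coface (n + 1) (n + 1))" if f: "f \<in> Hom Delta m n" for f m n
    unfolding functor_op_Comp[OF X c add_top_Hom[OF f]] functor_op_Comp[OF X f c]
    by (simp only: Delta_counit_r[OF f])
  then show ?thesis
    using functor_op_Hom[OF X c]
    unfolding simplicial_map_def is_nat_trans_def Dec_r_def counit_r_def face_def by simp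
qed

lemma simplicial_map_counit_l:
  assumes X: "simplicial_object P X"
  shows "simplicial_map P (Dec_l X) X (counit_l X)"
proof -
  have c: "coface (n + 1) 0 \<in> Hom Delta n (n + 1)" for n
    using coface_Hom[of "n + 1" 0] by simp
  have "arr_map X (coface (m + 1) 0) \<cdot>\<^bsub>P\<^esub> arr_map X (add_bot f) =
        arr_map X f \<cdot>\<^bsub>P\<^esub> arr_map X (coface (n + 1) 0)" if f: "f \<in> Hom Delta m n" for f m n
    unfolding functor_op_Comp[OF X c add_bot_Hom[OF f]] functor_op_Comp[OF X f c]
    by (simp only: Delta_counit_l[OF f])
  then show ?thesis
    using functor_op_Hom[OF X c]
    unfolding simplicial_map_def is_nat_trans_def Dec_l_def counit_l_def face_def by simp
qed

lemma simplicial_map_comult_r: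
  assumes X: "simplicial_object P X"
  shows "simplicial_map P (Dec_r X) (Dec_r (Dec_r X)) (comult_r X)"
proof -
  have c: "codegen (n + 1) (n + 1) \<in> Hom Delta (n + 1 + 1) (n + 1)" for n
    using codegen_Hom[of "n + 1" "n + 1"] by simp
  have "arr_map X (codegen (m + 1) (m + 1)) \<cdot>\<^bsub>P\<^esub> arr_map X (add_top f) =
        arr_map X (add_top (add_top f)) \<cdot>\<^bsub>P\<^esub> arr_map X (codegen (n + 1) (n + 1))"
    if f: "f \<in> Hom Delta m n" for f m n
    unfolding functor_op_Comp[OF X c add_top_Hom[OF f]]
      functor_op_Comp[OF X add_top_Hom[OF add_top_Hom[OF f]] c]
    by (simp only: Delta_comult_r[OF f])
  then show ?thesis
    using functor_op_Hom[OF X c]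
    unfolding simplicial_map_def is_nat_trans_def Dec_r_def comult_r_def degen_def by simp
qed

lemma simplicial_map_comult_l:
  assumes X: "simplicial_object P X"
  shows "simplicial_map P (Dec_l X) (Dec_l (Dec_l X)) (comult_l X)"
proof -
  have c: "codegen (n + 1) 0 \<in> Hom Delta (n + 1 + 1) (n + 1)" for n
    using codegen_Hom[of 0 "n + 1"] by simp
  have "arr_map X (codegen (m + 1) 0) \<cdot>\<^bsub>P\<^esub> arr_map X (add_bot f) =
        arr_map X (add_bot (add_bot f)) \<cdot>\<^bsub>P\<^esub> arr_map X (codegen (n + 1) 0)"
    if f: "f \<in> Hom Delta m n" for f m n
    unfolding functor_op_Comp[OF X c add_bot_Hom[OF f]]
      functor_op_Comp[OF X add_bot_Hom[OF add_bot_Hom[OF f]] c]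
    by (simp only: Delta_comult_l[OF f])
  then show ?thesis
    using functor_op_Hom[OF X c]
    unfolding simplicial_map_def is_nat_trans_def Dec_l_def comult_l_def degen_def by simp
qed

end

theory Submission
  imports Defs
begin

text \<open>
  Except in degree zero, the two structures are literally the same data subject to the same
  equations. A simplicial map is a family of components commuting with faces and degeneracies,
  since these generate the simplex category (\<open>Delta_induct\<close>); and the faces and degeneracies of the two decalages
  are those of \<open>X\<close> with the last, respectively the first, left out. So for a family
  \<open>u n = t (n + 1)\<close>, simpliciality of \<open>u\<close> says \<open>d\<^sub>i t = t d\<^bsub>i-1\<^esub>\<close> and \<open>s\<^sub>i t = t s\<^bsub>i-1\<^esub>\<close> among
  \<open>X\<^sub>1, X\<^sub>2, \<dots>\<close>, the counit equation says \<open>d\<^sub>0 t = d\<^bsub>n+1\<^esub>\<close>, and the comultiplication equation says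
  \<open>s\<^sub>0 t = t\<^sup>2 s\<^sub>n\<close> for \<open>n \<ge> 1\<close>. This is \<open>duplicial_iff_decalage\<close>.

  What remains of a duplicial structure is the component \<open>t\<^sub>0\<close> and two equations,
  \<open>d\<^sub>1 t\<^sub>1 = t\<^sub>0 d\<^sub>0\<close> and \<open>s\<^sub>0 t\<^sub>0 = t\<^sub>1\<^sup>2 s\<^sub>0\<close>. As \<open>d\<^sub>0 s\<^sub>0 = 1\<close>, the first of them forces
  \<open>t\<^sub>0 = d\<^sub>1 t\<^sub>1 s\<^sub>0\<close> (\<open>duplicial_degree_zero\<close>), and with this value both equations follow from those
  in positive degree (\<open>decalage_extends\<close>):

  \<open>d\<^sub>1 t\<^sub>1 s\<^sub>0 d\<^sub>0 = d\<^sub>1 t\<^sub>1 d\<^sub>0 s\<^sub>1 = d\<^sub>1 d\<^sub>1 t\<^sub>2 s\<^sub>1 = d\<^sub>1 d\<^sub>2 t\<^sub>2 s\<^sub>1 = d\<^sub>1 t\<^sub>1 d\<^sub>1 s\<^sub>1 = d\<^sub>1 t\<^sub>1\<close>,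

  \<open>s\<^sub>0 d\<^sub>1 t\<^sub>1 s\<^sub>0 = d\<^sub>2 s\<^sub>0 t\<^sub>1 s\<^sub>0 = d\<^sub>2 t\<^sub>2 t\<^sub>2 s\<^sub>1 s\<^sub>0 = t\<^sub>1 d\<^sub>1 t\<^sub>2 s\<^sub>1 s\<^sub>0 = t\<^sub>1 t\<^sub>1 d\<^sub>0 s\<^sub>1 s\<^sub>0 = t\<^sub>1\<^sup>2 s\<^sub>0\<close>.
\<close>

section \<open>Generation of the simplex category\<close>

text \<open>The image of \<open>f\<close> lies in that of the coface omitting \<open>j\<close>, which is injective; lowering the values
  above \<open>j\<close> by one gives the other factor.\<close>

lemma Delta_factor_coface:
  assumes f: "f \<in> {..m} \<rightarrow>\<^sub>E {..Suc n}" "mono_on {..m} f"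
    and j: "j \<le> Suc n" "j \<notin> f ` {..m}"
  obtains g where "g \<in> Hom Delta m n" "(m, Suc n, f) = coface (Suc n) j \<cdot>\<^bsub>Delta\<^esub> g"
proof
  let ?h = "\<lambda>k. if f k < j then f k else f k - 1"
  let ?g = "restrict ?h {..m}"
  have ne: "f k \<noteq> j" if "k \<le> m" for k
    using that j(2) by auto
  have le: "f k \<le> Suc n" if "k \<le> m" for k
    using that f(1) by auto
  have mono: "f k \<le> f l" if "k \<le> l" "l \<le> m" for k l
    using that f(2) by (auto simp: mono_on_def)
  have bound: "?h k \<le> n" if "k \<le> m" for k
    using ne[OF that] le[OF that] j(1) by auto
  have h_mono: "?h k \<le> ?h l" if "k \<le> l" "l \<le> m" for k l
    using mono[OF that] ne[of k] ne[of l] that by auto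
  have "?g \<in> {..m} \<rightarrow>\<^sub>E {..n}"
    unfolding restrict_PiE_iff using bound by blast
  moreover have "mono_on {..m} ?g"
    using h_mono by (intro mono_onI) (simp only: restrict_apply atMost_iff if_True)
  ultimately show "(m, n, ?g) \<in> Hom Delta m n"
    by (simp only: Hom_Delta) blast
  have "compose {..m} (\<lambda>k\<in>{..n}. if k < j then k else k + 1) ?g k = f k" for k
  proof (cases "k \<le> m")
    case True
    then show ?thesis
      using bound[OF True] ne[OF True] by (simp add: compose_def split: if_splits)
  next
    case False
    then show ?thesis
      using PiE_arb[OF f(1), of k] by (simp add: compose_def)
  qed
  then show "(m, Suc n, f) = coface (Suc n) j \<cdot>\<^bsub>Delta\<^esub> (m, n, ?g)"
    by (simp add: coface_def fun_eq_iff)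
qed

text \<open>Since \<open>f\<close> is constant on the fibres of \<open>codegen m i\<close>, it descends along this surjection; the
  other factor is \<open>f\<close> with its value at \<open>i + 1\<close> skipped.\<close>

lemma Delta_factor_codegen:
  assumes f: "f \<in> {..Suc m} \<rightarrow>\<^sub>E {..n}" "mono_on {..Suc m} f"
    and i: "i \<le> m" "f i = f (Suc i)"
  obtains g where "g \<in> Hom Delta m n" "(Suc m, n, f) = g \<cdot>\<^bsub>Delta\<^esub> codegen m i"
proof
  let ?g = "\<lambda>k\<in>{..m}. if k \<le> i then f k else f (Suc k)"
  have "f k \<le> f l" if "k \<le> l" "l \<le> Suc m" for k l
    using that f(2) by (auto simp: mono_on_def)
  moreover have "f k \<le> n" if "k \<le> Suc m" for k
    using that f(1) by auto
  ultimately show "(m, n, ?g) \<in> Hom Delta m n"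
    by (auto simp: Hom_Delta mono_on_def)
  have "compose {..Suc m} ?g (\<lambda>k\<in>{..m + 1}. if k \<le> i then k else k - 1) k = f k" for k
  proof (cases "k = Suc i")
    case False
    then show ?thesis
      using i PiE_arb[OF f(1), of k] by (auto simp: compose_def Suc_diff_Suc not_le)
  qed (use i in \<open>auto simp: compose_def\<close>)
  then show "(Suc m, n, f) = (m, n, ?g) \<cdot>\<^bsub>Delta\<^esub> codegen m i"
    by (simp add: codegen_def fun_eq_iff)
qed

text \<open>Cofaces and codegeneracies generate \<open>Delta\<close>. For a map \<open>f : [m] \<rightarrow> [n]\<close>, consider the first
  \<open>k\<close> with \<open>f k \<noteq> k\<close>: if \<open>f k > k\<close>, then \<open>f\<close> omits \<open>k\<close>; if \<open>f k < k\<close>, then monotonicity and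
  \<open>f (k - 1) = k - 1\<close> give \<open>f (k - 1) = f k\<close>. If there is no such \<open>k\<close>, then \<open>f\<close> is an identity or
  omits \<open>n\<close>. Each factorisation lowers \<open>m + n\<close>.\<close>

lemma Delta_induct [consumes 1, case_names Id coface codegen Comp]:
  assumes f: "f \<in> Hom Delta m n"
    and ident: "\<And>n. Q n n (Id Delta n)"
    and coface: "\<And>n i. i \<le> Suc n \<Longrightarrow> Q n (Suc n) (coface (Suc n) i)"
    and codegen: "\<And>n i. i \<le> n \<Longrightarrow> Q (Suc n) n (codegen n i)"
    and Comp: "\<And>a b c f g. f \<in> Hom Delta a b \<Longrightarrow> g \<in> Hom Delta b c \<Longrightarrow>
      Q a b f \<Longrightarrow> Q b c g \<Longrightarrow> Q a c (g \<cdot>\<^bsub>Delta\<^esub> f)"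
  shows "Q m n f"
  using f
proof (induction "m + n" arbitrary: m n f rule: less_induct)
  case less
  from less.prems obtain h where f: "f = (m, n, h)"
    and h: "h \<in> {..m} \<rightarrow>\<^sub>E {..n}" "mono_on {..m} h"
    by (auto simp: Hom_Delta)
  have mono: "h k \<le> h l" if "k \<le> l" "l \<le> m" for k l
    using that h(2) by (auto simp: mono_on_def)
  have le: "h k \<le> n" if "k \<le> m" for k
    using that h(1) by auto
  have omits: ?case if j: "j \<le> n" "j \<notin> h ` {..m}" for j
  proof (cases n)
    case 0
    then show ?thesis
      using j le[of 0] by force
  next
    case (Suc n')
    obtain g where g: "g \<in> Hom Delta m n'" "f = coface (Suc n') j \<cdot>\<^bsub>Delta\<^esub> g"
      using Delta_factor_coface[of h m n' j] h j f Suc by auto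
    have "coface (Suc n') j \<in> Hom Delta n' (Suc n')"
      using coface_Hom[of "Suc n'" j] j Suc by simp
    with g show ?thesis
      using Comp[OF g(1) _ less.hyps[OF _ g(1)] coface] j Suc by simp
  qed
  have repeats: ?case if i: "i < m" "h i = h (Suc i)" for i
  proof -
    obtain m' where m': "m = Suc m'"
      using i(1) by (cases m) auto
    obtain g where g: "g \<in> Hom Delta m' n" "f = g \<cdot>\<^bsub>Delta\<^esub> codegen m' i"
      using Delta_factor_codegen[of h m' n i] h i f m' by auto
    have "codegen m' i \<in> Hom Delta (Suc m') m'"
      using codegen_Hom[of i m'] i m' by simp
    with g show ?thesis
      using Comp[OF _ g(1) codegen less.hyps[OF _ g(1)]] i m' by simp
  qed
  show ?case
  proof (cases "\<exists>k\<le>m. h k \<noteq> k")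
    case True
    define k where "k = (LEAST k. k \<le> m \<and> h k \<noteq> k)"
    have k: "k \<le> m" "h k \<noteq> k"
      using LeastI_ex[of "\<lambda>k. k \<le> m \<and> h k \<noteq> k"] True by (auto simp: k_def)
    have below: "h l = l" if "l < k" for l
      using not_less_Least[of l "\<lambda>k. k \<le> m \<and> h k \<noteq> k"] that k(1) by (auto simp: k_def)
    show ?thesis
    proof (cases "h k > k")
      case True
      have "h l \<noteq> k" if "l \<le> m" for l
        using below[of l] mono[of k l] that True by (cases "l < k") auto
      then show ?thesis
        using omits[of k] True le[OF k(1)] by auto
    next
      case False
      with k(2) have "h k < k" by simp
      moreover from this obtain l where l: "k = Suc l"
        by (cases k) auto
      ultimately have "h l = h (Suc l)"
        using below[of l] mono[of l k] k(1) by simp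
      then show ?thesis
        using repeats[of l] l k(1) by simp
    qed
  next
    case False
    then have id: "h k = k" if "k \<le> m" for k
      using that by auto
    show ?thesis
    proof (cases "m = n")
      case True
      have "h = (\<lambda>k\<in>{..n}. k)"
        using id PiE_arb[OF h(1)] True by (auto simp: fun_eq_iff)
      then show ?thesis
        using ident[of n] f True by simp
    next
      case False
      with le[of m] id have "m < n" by fastforce
      then show ?thesis
        using omits[of n] id by auto
    qed
  qed
qed

section \<open>Simplicial objects by faces and degeneracies\<close>

lemma coface_Suc_Hom: "i \<le> Suc n \<Longrightarrow> coface (Suc n) i \<in> Hom Delta n (Suc n)"
  using coface_Hom[of "Suc n" i] by simp

lemma codegen_Suc_Hom: "i \<le> n \<Longrightarrow> codegen n i \<in> Hom Delta (Suc n) n"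
  using codegen_Hom[of i n] by simp

text \<open>In these forms of the category axioms the side conditions determine all objects from the
  arrows, so that the simplifier can discharge them.\<close>

context category
begin

lemma Hom_iff: "f \<in> Hom C a b \<longleftrightarrow> f \<in> Arr C \<and> Dom C f = a \<and> Cod C f = b"
  by (simp add: Hom_def)

lemma Comp_arr:
  assumes "f \<in> Arr C" "g \<in> Arr C" "Dom C g = Cod C f"
  shows "g \<cdot> f \<in> Arr C" "Dom C (g \<cdot> f) = Dom C f" "Cod C (g \<cdot> f) = Cod C g"
  using Comp_Hom[of f "Dom C f" "Cod C f" g "Cod C g"] assms by (simp_all add: Hom_iff)

lemma Comp_assoc_arr:
  assumes "f \<in> Arr C" "g \<in> Arr C" "h \<in> Arr C" "Dom C g = Cod C f" "Dom C h = Cod C g"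
  shows "(h \<cdot> g) \<cdot> f = h \<cdot> (g \<cdot> f)"
  using Comp_assoc[of f "Dom C f" "Cod C f" g "Cod C g" h "Cod C h"] assms by (simp add: Hom_iff)

lemma Id_right_arr: "f \<in> Arr C \<Longrightarrow> Dom C f = a \<Longrightarrow> f \<cdot> Id C a = f"
  using Id_right[of f a "Cod C f"] by (simp add: Hom_iff)

end

locale simplicial = category P for P :: "('o, 'm) cat" (structure) +
  fixes X :: "('o, 'm) sobj"
  assumes simplicial_object: "simplicial_object P X"
begin

abbreviation d :: "nat \<Rightarrow> nat \<Rightarrow> 'm" where "d \<equiv> face X"
abbreviation s :: "nat \<Rightarrow> nat \<Rightarrow> 'm" where "s \<equiv> degen X"

lemma face_Hom: "i \<le> Suc n \<Longrightarrow> d (Suc n) i \<in> Hom P (ob_map X (Suc n)) (ob_map X n)"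
  using functor_op_Hom[OF simplicial_object coface_Hom[of "Suc n" i]] by (simp add: face_def)

lemma degen_Hom: "i \<le> n \<Longrightarrow> s n i \<in> Hom P (ob_map X n) (ob_map X (Suc n))"
  using functor_op_Hom[OF simplicial_object codegen_Hom[of i n]] by (simp add: degen_def)

lemma arr_map_Comp_eq:
  assumes "f \<in> Hom Delta a b" "g \<in> Hom Delta b c" "f' \<in> Hom Delta a b'" "g' \<in> Hom Delta b' c"
    and "g \<cdot>\<^bsub>Delta\<^esub> f = g' \<cdot>\<^bsub>Delta\<^esub> f'"
  shows "arr_map X f \<cdot> arr_map X g = arr_map X f' \<cdot> arr_map X g'"
  using functor_op_Comp[OF simplicial_object assms(1,2)]
    functor_op_Comp[OF simplicial_object assms(3,4)] assms(5) by simp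

lemma face_face:
  assumes "i \<le> j" "j \<le> Suc n"
  shows "d (Suc n) i \<cdot> d (Suc (Suc n)) (Suc j) = d (Suc n) j \<cdot> d (Suc (Suc n)) i"
proof -
  have eq: "coface (Suc (Suc n)) (Suc j) \<cdot>\<^bsub>Delta\<^esub> coface (Suc n) i =
        coface (Suc (Suc n)) i \<cdot>\<^bsub>Delta\<^esub> coface (Suc n) j"
    using assms by (auto simp: coface_def compose_def fun_eq_iff)
  show ?thesis
    unfolding face_def
    by (rule arr_map_Comp_eq[OF coface_Suc_Hom coface_Suc_Hom coface_Suc_Hom coface_Suc_Hom eq])
      (use assms in auto)
qed

lemma face_degen_below:
  assumes "i \<le> j" "j \<le> n"
  shows "d (Suc (Suc n)) i \<cdot> s (Suc n) (Suc j) = s n j \<cdot> d (Suc n) i"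
proof -
  have eq: "codegen (Suc n) (Suc j) \<cdot>\<^bsub>Delta\<^esub> coface (Suc (Suc n)) i =
        coface (Suc n) i \<cdot>\<^bsub>Delta\<^esub> codegen n j"
    using assms by (auto simp: coface_def codegen_def compose_def fun_eq_iff)
  show ?thesis
    unfolding face_def degen_def
    by (rule arr_map_Comp_eq[OF coface_Suc_Hom codegen_Suc_Hom codegen_Suc_Hom coface_Suc_Hom eq])
      (use assms in auto)
qed

lemma face_degen_above:
  assumes "j < i" "i \<le> Suc n"
  shows "d (Suc (Suc n)) (Suc i) \<cdot> s (Suc n) j = s n j \<cdot> d (Suc n) i"
proof -
  have eq: "codegen (Suc n) j \<cdot>\<^bsub>Delta\<^esub> coface (Suc (Suc n)) (Suc i) =
        coface (Suc n) i \<cdot>\<^bsub>Delta\<^esub> codegen n j"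
    using assms by (auto simp: coface_def codegen_def compose_def fun_eq_iff)
  show ?thesis
    unfolding face_def degen_def
    by (rule arr_map_Comp_eq[OF coface_Suc_Hom codegen_Suc_Hom codegen_Suc_Hom coface_Suc_Hom eq])
      (use assms in auto)
qed

lemma face_degen_same:
  assumes "j \<le> n" "i = j \<or> i = Suc j"
  shows "d (Suc n) i \<cdot> s n j = Id P (ob_map X n)"
proof -
  have "codegen n j \<cdot>\<^bsub>Delta\<^esub> coface (Suc n) i = Id Delta n"
    using assms by (auto simp: coface_def codegen_def compose_def fun_eq_iff)
  moreover have "arr_map X (Id Delta n) = Id P (ob_map X n)"
    using simplicial_object by (simp add: simplicial_object_def is_functor_def del: Delta_simps(4))
  moreover have "coface (Suc n) i \<in> Hom Delta n (Suc n)" "codegen n j \<in> Hom Delta (Suc n) n"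
    using assms coface_Suc_Hom codegen_Suc_Hom by auto
  ultimately show ?thesis
    by (simp add: face_def degen_def functor_op_Comp[OF simplicial_object] del: Delta_simps(4))
qed

end

text \<open>Naturality squares compose, so it is enough to check naturality on generators of \<open>Delta\<close>.\<close>

lemma simplicial_map_iff_face_degen:
  assumes "category P" and X: "simplicial_object P X" and Y: "simplicial_object P Y"
  shows "simplicial_map P X Y t \<longleftrightarrow>
    (\<forall>n. t n \<in> Hom P (ob_map X n) (ob_map Y n)) \<and>
    (\<forall>n. \<forall>i\<le>Suc n. t n \<cdot>\<^bsub>P\<^esub> face X (Suc n) i = face Y (Suc n) i \<cdot>\<^bsub>P\<^esub> t (Suc n)) \<and>
    (\<forall>n. \<forall>i\<le>n. t (Suc n) \<cdot>\<^bsub>P\<^esub> degen X n i = degen Y n i \<cdot>\<^bsub>P\<^esub> t n)"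
    (is "_ \<longleftrightarrow> ?typed \<and> ?faces \<and> ?degens")
proof
  assume t: "simplicial_map P X Y t"
  then have "t m \<cdot>\<^bsub>P\<^esub> arr_map X f = arr_map Y f \<cdot>\<^bsub>P\<^esub> t n" if "f \<in> Hom Delta m n" for f m n
    using that by (simp add: simplicial_map_def is_nat_trans_def)
  then show "?typed \<and> ?faces \<and> ?degens"
    using t coface_Hom[of "Suc _"] codegen_Hom
    by (simp add: simplicial_map_def is_nat_trans_def face_def degen_def)
next
  interpret category P by fact
  assume r: "?typed \<and> ?faces \<and> ?degens"
  then have t: "t n \<in> Hom P (ob_map X n) (ob_map Y n)" for n
    by blast
  have "t m \<cdot>\<^bsub>P\<^esub> arr_map X f = arr_map Y f \<cdot>\<^bsub>P\<^esub> t n" if "f \<in> Hom Delta m n" for f m n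
    using that
  proof (induction rule: Delta_induct)
    case (Id n)
    have "arr_map X (Id Delta n) = Id P (ob_map X n)" "arr_map Y (Id Delta n) = Id P (ob_map Y n)"
      using X Y by (simp_all add: simplicial_object_def is_functor_def del: Delta_simps(4))
    then show ?case
      using t Id_left Id_right by metis
  next
    case (coface n i)
    then show ?case using r by (simp add: face_def)
  next
    case (codegen n i)
    then show ?case using r by (simp add: degen_def)
  next
    case (Comp a b c f g)
    note Xf = functor_op_Hom[OF X Comp(1)] and Yf = functor_op_Hom[OF Y Comp(1)]
      and Xg = functor_op_Hom[OF X Comp(2)] and Yg = functor_op_Hom[OF Y Comp(2)]
    have "t a \<cdot>\<^bsub>P\<^esub> (arr_map X f \<cdot>\<^bsub>P\<^esub> arr_map X g) = (t a \<cdot>\<^bsub>P\<^esub> arr_map X f) \<cdot>\<^bsub>P\<^esub> arr_map X g"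
      using Comp_assoc[OF Xg Xf t] .
    also have "\<dots> = arr_map Y f \<cdot>\<^bsub>P\<^esub> (t b \<cdot>\<^bsub>P\<^esub> arr_map X g)"
      using Comp_assoc[OF Xg t Yf] Comp(3) by simp
    also have "\<dots> = (arr_map Y f \<cdot>\<^bsub>P\<^esub> arr_map Y g) \<cdot>\<^bsub>P\<^esub> t c"
      using Comp_assoc[OF t Yg Yf] Comp(4) by simp
    finally show ?case
      by (simp only: functor_op_Comp[OF X Comp(1,2)] functor_op_Comp[OF Y Comp(1,2)])
  qed
  with t show "simplicial_map P X Y t"
    by (simp add: simplicial_map_def is_nat_trans_def)
qed

section \<open>Duplicial structure in positive degrees\<close>

definition decalage_structure ::
  "('o, 'm) cat \<Rightarrow> ('o, 'm) sobj \<Rightarrow> (nat \<Rightarrow> 'm) \<Rightarrow> bool" where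
  "decalage_structure P X u \<longleftrightarrow>
     simplicial_map P (Dec_r X) (Dec_l X) u \<and>
     smap_comp P (counit_l X) u = counit_r X \<and>
     smap_comp P (comult_l X) u =
       smap_comp P (Dec_l_map u) (smap_comp P (Dec_r_map u) (comult_r X))"

context simplicial
begin

lemma decalage_structure_iff:
  "decalage_structure P X u \<longleftrightarrow>
    (\<forall>n. u n \<in> Hom P (ob_map X (Suc n)) (ob_map X (Suc n))) \<and>
    (\<forall>n. \<forall>i\<le>Suc n. d (Suc (Suc n)) (Suc i) \<cdot> u (Suc n) = u n \<cdot> d (Suc (Suc n)) i) \<and>
    (\<forall>n. d (Suc n) 0 \<cdot> u n = d (Suc n) (Suc n)) \<and>
    (\<forall>n. \<forall>i\<le>n. s (Suc n) (Suc i) \<cdot> u n = u (Suc n) \<cdot> s (Suc n) i) \<and>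
    (\<forall>n. s (Suc n) 0 \<cdot> u n = (u (Suc n) \<cdot> u (Suc n)) \<cdot> s (Suc n) (Suc n))"
proof -
  (* The comultiplication equation brackets the triple product the other way. *)
  have "u (Suc n) \<cdot> (u (Suc n) \<cdot> s (Suc n) (Suc n)) = (u (Suc n) \<cdot> u (Suc n)) \<cdot> s (Suc n) (Suc n)"
    if "\<forall>n. u n \<in> Hom P (ob_map X (Suc n)) (ob_map X (Suc n))" for n
    using that degen_Hom[of "Suc n" "Suc n"] by (metis Comp_assoc order_refl)
  moreover have "ob_map (Dec_r X) n = ob_map X (Suc n)" "ob_map (Dec_l X) n = ob_map X (Suc n)" for n
    by (simp_all add: Dec_r_def Dec_l_def)
  ultimately show ?thesis
    unfolding decalage_structure_def simplicial_map_iff_face_degen[OF category_axioms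
        simplicial_object_Dec_r[OF simplicial_object] simplicial_object_Dec_l[OF simplicial_object]]
    by (auto simp: face_Dec_r face_Dec_l degen_Dec_r degen_Dec_l smap_comp_def counit_l_def
        counit_r_def comult_l_def comult_r_def Dec_l_map_def Dec_r_map_def fun_eq_iff)
qed

lemma duplicial_structure_Suc_iff:
  "duplicial_structure P X t \<longleftrightarrow>
    (\<forall>n. t n \<in> Hom P (ob_map X n) (ob_map X n)) \<and>
    (\<forall>n. \<forall>i\<le>n. d (Suc n) (Suc i) \<cdot> t (Suc n) = t n \<cdot> d (Suc n) i) \<and>
    (\<forall>n. d (Suc n) 0 \<cdot> t (Suc n) = d (Suc n) (Suc n)) \<and>
    (\<forall>n. \<forall>i<n. s n (Suc i) \<cdot> t n = t (Suc n) \<cdot> s n i) \<and>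
    (\<forall>n. s n 0 \<cdot> t n = (t (Suc n) \<cdot> t (Suc n)) \<cdot> s n n)"
proof -
  have shift: "(\<forall>i\<in>{1..k}. Q i) \<longleftrightarrow> (\<forall>i<k. Q (Suc i))" for k and Q :: "nat \<Rightarrow> bool"
    by (simp only: image_Suc_lessThan[symmetric] ball_simps) auto
  show ?thesis
    unfolding duplicial_structure_def shift by (auto simp: less_Suc_eq_le)
qed

lemma all_nat_split: "(\<forall>n. Q n) \<longleftrightarrow> Q 0 \<and> (\<forall>n. Q (Suc n))" for Q :: "nat \<Rightarrow> bool"
  by (metis nat.exhaust)

lemma duplicial_iff_decalage:
  "duplicial_structure P X t \<longleftrightarrow>
    decalage_structure P X (\<lambda>n. t (Suc n)) \<and>
    t 0 \<in> Hom P (ob_map X 0) (ob_map X 0) \<and>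
    d 1 1 \<cdot> t 1 = t 0 \<cdot> d 1 0 \<and>
    s 0 0 \<cdot> t 0 = (t 1 \<cdot> t 1) \<cdot> s 0 0"
  unfolding duplicial_structure_Suc_iff decalage_structure_iff
    all_nat_split[of "\<lambda>n. t n \<in> Hom P (ob_map X n) (ob_map X n)"]
    all_nat_split[of "\<lambda>n. \<forall>i\<le>n. d (Suc n) (Suc i) \<cdot> t (Suc n) = t n \<cdot> d (Suc n) i"]
    all_nat_split[of "\<lambda>n. \<forall>i<n. s n (Suc i) \<cdot> t n = t (Suc n) \<cdot> s n i"]
    all_nat_split[of "\<lambda>n. s n 0 \<cdot> t n = (t (Suc n) \<cdot> t (Suc n)) \<cdot> s n n"]
  by (simp only: less_Suc_eq_le le_zero_eq less_nat_zero_code One_nat_def simp_thms conj_ac)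

section \<open>The component in degree zero\<close>

text \<open>Precompose \<open>d\<^sub>1 t\<^sub>1 = t\<^sub>0 d\<^sub>0\<close> with the section \<open>s\<^sub>0\<close> of \<open>d\<^sub>0\<close>.\<close>

lemma duplicial_degree_zero:
  assumes "duplicial_structure P X t"
  shows "t 0 = (d 1 1 \<cdot> t 1) \<cdot> s 0 0"
proof -
  have t0: "t 0 \<in> Hom P (ob_map X 0) (ob_map X 0)" and eq: "d 1 1 \<cdot> t 1 = t 0 \<cdot> d 1 0"
    using assms by (auto simp: duplicial_iff_decalage)
  have "(t 0 \<cdot> d 1 0) \<cdot> s 0 0 = t 0 \<cdot> (d 1 0 \<cdot> s 0 0)"
    using Comp_assoc[OF degen_Hom face_Hom t0, of 0 0] by simp
  also have "\<dots> = t 0"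
    using face_degen_same[of 0 0 0] Id_right[OF t0] by simp
  finally show ?thesis
    by (simp only: eq)
qed

text \<open>Conversely, the two chains of equations displayed at the beginning; the second one uses the
  comultiplication equation in the form \<open>s\<^sub>0 t\<^sub>1 = t\<^sub>2\<^sup>2 s\<^sub>1\<close>. Here \<open>u n\<close> is \<open>t\<^bsub>n+1\<^esub>\<close>.\<close>

lemma decalage_extends:
  assumes "decalage_structure P X u"
  shows "duplicial_structure P X (case_nat ((d 1 1 \<cdot> u 0) \<cdot> s 0 0) u)"
proof -
  let ?X = "ob_map X"
  have u: "u n \<in> Hom P (?X (Suc n)) (?X (Suc n))"
    and d_u: "i \<le> Suc n \<Longrightarrow> d (Suc (Suc n)) (Suc i) \<cdot> u (Suc n) = u n \<cdot> d (Suc (Suc n)) i"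
    and s0_u: "s (Suc n) 0 \<cdot> u n = (u (Suc n) \<cdot> u (Suc n)) \<cdot> s (Suc n) (Suc n)" for n i
    using assms by (auto simp: decalage_structure_iff)
  have H: "d 1 0 \<in> Hom P (?X 1) (?X 0)" "d 1 1 \<in> Hom P (?X 1) (?X 0)"
    "d 2 0 \<in> Hom P (?X 2) (?X 1)" "d 2 1 \<in> Hom P (?X 2) (?X 1)" "d 2 2 \<in> Hom P (?X 2) (?X 1)"
    "s 0 0 \<in> Hom P (?X 0) (?X 1)" "s 1 0 \<in> Hom P (?X 1) (?X 2)" "s 1 1 \<in> Hom P (?X 1) (?X 2)"
    "u 0 \<in> Hom P (?X 1) (?X 1)" "u 1 \<in> Hom P (?X 2) (?X 2)"
    using face_Hom[of _ 0] face_Hom[of _ 1] degen_Hom[of _ 0] degen_Hom[of _ 1] u[of 0] u[of 1]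
    by (simp_all add: numeral_2_eq_2)
  note typed = H[unfolded Hom_iff, THEN conjunct1] H[unfolded Hom_iff, THEN conjunct2, THEN conjunct1]
    H[unfolded Hom_iff, THEN conjunct2, THEN conjunct2] Comp_arr
  have ds: "d 1 0 \<cdot> s 0 0 = Id P (?X 0)" "d 2 1 \<cdot> s 1 1 = Id P (?X 1)"
    "d 2 0 \<cdot> s 1 1 = s 0 0 \<cdot> d 1 0" "d 2 2 \<cdot> s 1 0 = s 0 0 \<cdot> d 1 1"
    "d 1 1 \<cdot> d 2 2 = d 1 1 \<cdot> d 2 1"
    using face_degen_same[of 0 0 0] face_degen_same[of 1 1 1] face_degen_below[of 0 0 0]
      face_degen_above[of 0 1 0] face_face[of 1 1 0] by (simp_all add: numeral_2_eq_2)
  have du: "d 2 1 \<cdot> u 1 = u 0 \<cdot> d 2 0" "d 2 2 \<cdot> u 1 = u 0 \<cdot> d 2 1"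
    "s 1 0 \<cdot> u 0 = (u 1 \<cdot> u 1) \<cdot> s 1 1"
    using d_u[of 0 0] d_u[of 1 0] s0_u[of 0] by (simp_all add: numeral_2_eq_2)
  define t0 where "t0 = (d 1 1 \<cdot> u 0) \<cdot> s 0 0"
  have "t0 \<in> Hom P (?X 0) (?X 0)"
    by (simp only: t0_def Hom_iff typed)
  moreover have "d 1 1 \<cdot> u 0 = t0 \<cdot> d 1 0"
  proof -
    have "t0 \<cdot> d 1 0 = (d 1 1 \<cdot> u 0) \<cdot> (s 0 0 \<cdot> d 1 0)"
      unfolding t0_def by (simp only: Comp_assoc_arr typed)
    also have "\<dots> = (d 1 1 \<cdot> u 0) \<cdot> (d 2 0 \<cdot> s 1 1)"
      by (simp only: ds)
    also have "\<dots> = (d 1 1 \<cdot> (u 0 \<cdot> d 2 0)) \<cdot> s 1 1"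
      by (simp only: Comp_assoc_arr typed)
    also have "\<dots> = ((d 1 1 \<cdot> d 2 1) \<cdot> u 1) \<cdot> s 1 1"
      unfolding du(1)[symmetric] by (simp only: Comp_assoc_arr typed)
    also have "\<dots> = (d 1 1 \<cdot> (d 2 2 \<cdot> u 1)) \<cdot> s 1 1"
      unfolding ds(5)[symmetric] by (simp only: Comp_assoc_arr typed)
    also have "\<dots> = (d 1 1 \<cdot> u 0) \<cdot> (d 2 1 \<cdot> s 1 1)"
      unfolding du(2) by (simp only: Comp_assoc_arr typed)
    also have "\<dots> = d 1 1 \<cdot> u 0"
      unfolding ds by (simp only: Id_right_arr typed)
    finally show ?thesis by simp
  qed
  moreover have "s 0 0 \<cdot> t0 = (u 0 \<cdot> u 0) \<cdot> s 0 0"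
  proof -
    have "s 0 0 \<cdot> t0 = ((s 0 0 \<cdot> d 1 1) \<cdot> u 0) \<cdot> s 0 0"
      unfolding t0_def by (simp only: Comp_assoc_arr typed)
    also have "\<dots> = (d 2 2 \<cdot> (s 1 0 \<cdot> u 0)) \<cdot> s 0 0"
      unfolding ds(4)[symmetric] by (simp only: Comp_assoc_arr typed)
    also have "\<dots> = (((d 2 2 \<cdot> u 1) \<cdot> u 1) \<cdot> s 1 1) \<cdot> s 0 0"
      unfolding du(3) by (simp only: Comp_assoc_arr typed)
    also have "\<dots> = ((u 0 \<cdot> (d 2 1 \<cdot> u 1)) \<cdot> s 1 1) \<cdot> s 0 0"
      unfolding du(2) by (simp only: Comp_assoc_arr typed)
    also have "\<dots> = ((u 0 \<cdot> u 0) \<cdot> (d 2 0 \<cdot> s 1 1)) \<cdot> s 0 0"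
      unfolding du(1) by (simp only: Comp_assoc_arr typed)
    also have "\<dots> = ((u 0 \<cdot> u 0) \<cdot> s 0 0) \<cdot> (d 1 0 \<cdot> s 0 0)"
      unfolding ds(3) by (simp only: Comp_assoc_arr typed)
    also have "\<dots> = (u 0 \<cdot> u 0) \<cdot> s 0 0"
      unfolding ds(1) by (simp only: Id_right_arr typed)
    finally show ?thesis .
  qed
  ultimately show ?thesis
    using assms by (simp add: duplicial_iff_decalage t0_def)
qed

end

theorem proposition2p2:
  fixes P :: "('o, 'm) cat" and X :: "('o, 'm) sobj"
  assumes "category P"
    and "simplicial_object P X"
  shows "bij_betw (\<lambda>t n. t (n + 1))
    {t. duplicial_structure P X t}
    {t. simplicial_map P (Dec_r X) (Dec_l X) t \<and>
        smap_comp P (counit_l X) t = counit_r X \<and>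
        smap_comp P (comult_l X) t =
          smap_comp P (Dec_l_map t) (smap_comp P (Dec_r_map t) (comult_r X))}"
proof -
  interpret simplicial P X
    using assms by (simp add: simplicial_def simplicial_axioms_def)
  have recover: "case_nat ((d 1 1 \<cdot>\<^bsub>P\<^esub> t 1) \<cdot>\<^bsub>P\<^esub> s 0 0) (\<lambda>n. t (Suc n)) = t"
    if "duplicial_structure P X t" for t
    using duplicial_degree_zero[OF that] by (auto simp: fun_eq_iff split: nat.split)
  have "bij_betw (\<lambda>t n. t (n + 1)) {t. duplicial_structure P X t} {u. decalage_structure P X u}"
    by (rule bij_betw_byWitness[where f' = "\<lambda>u. case_nat ((d 1 1 \<cdot>\<^bsub>P\<^esub> u 0) \<cdot>\<^bsub>P\<^esub> s 0 0) u"])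
      (use recover decalage_extends in \<open>auto simp: duplicial_iff_decalage\<close>)
  then show ?thesis
    by (simp add: decalage_structure_def)
qed

end
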